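(* Let $k=k_n$ be positive integers with $n>2k$ and $k\to\infty$ as $n\to\infty$. Let a random family of $k$-element subsets of an $n$-element set be obtained by selecting each of the $\binom{n}{k}$ $k$-sets independently with probability $p=p_n\in[0,1]$, and let $X_0$ be the number of unordered pairs of disjoint sets in the selected family. If $$p=o\left(\frac{1}{\binom{n-k}{k}}\right)\quad\text{as } n\to\infty,$$ then, with $\lambda=\frac12\binom{n}{k}\binom{n-k}{k}p^2$, $$d_{TV}\big(\mathcal{L}(X_0),\mathrm{Po}(\lambda)\big)\to 0\quad\text{as } n\to\infty.$$
   Context: $\mathcal{L}(Z)$ denotes the distribution of the random variable $Z$, $\mathrm{Po}(\lambda)$ the Poisson distribution with mean $\lambda$ (the point mass at $0$ if $\lambda=0$), and $d_{TV}$ the total variation distance between probability distributions, $d_{TV}(\mu,\nu)=\sup_B|\mu(B)-\nu(B)|$. *)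

theory Defs
  imports "HOL-Probability.Probability" "HOL-Library.Landau_Symbols" "HOL-Library.Ramsey"
begin

text \<open>
  The selected family itself is the random object: the Boolean assignment produced by
  \<^const>\<open>Pi_pmf\<close> is turned into the set of those \<open>k\<close>-subsets of \<open>V\<close> that are assigned \<^const>\<open>True\<close>.
\<close>
definition random_family :: "'a set \<Rightarrow> nat \<Rightarrow> real \<Rightarrow> 'a set set pmf" where
  "random_family V k p =
     map_pmf (\<lambda>sel. {A \<in> nsets V k. sel A}) (Pi_pmf (nsets V k) False (\<lambda>_. bernoulli_pmf p))"

definition disjoint_pairs :: "'a set set \<Rightarrow> 'a set set set" where
  "disjoint_pairs F = {{A, B} | A B. A \<in> F \<and> B \<in> F \<and> A \<noteq> B \<and> A \<inter> B = {}}"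

text \<open>
  \<^const>\<open>poisson_pmf\<close> is only specified for a positive rate, so the point mass for rate \<open>0\<close> is
  added here. Negative rates are meaningless.
\<close>
definition poisson_law :: "real \<Rightarrow> nat pmf" where
  "poisson_law rate = (if rate = 0 then return_pmf 0 else poisson_pmf rate)"

definition tv_dist :: "'a pmf \<Rightarrow> 'a pmf \<Rightarrow> real" where
  "tv_dist \<mu> \<nu> = (SUP B. \<bar>measure_pmf.prob \<mu> B - measure_pmf.prob \<nu> B\<bar>)"

end

theory Submission
  imports Defs
begin

text \<open>
  The selected family is a random set of vertices of the Kneser graph, whose vertices are the
  \<open>k\<close>-subsets of \<open>V\<close> and whose edges are the disjoint pairs. This graph is regular of degree
  \<open>D = (n - k) choose k\<close> (\<open>card_kneser_neighbours\<close>), so it has \<open>(n choose k) * D / 2\<close> edges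
  (\<open>card_kneser_edges\<close>), and \<open>X\<^sub>0\<close> is the number of edges with both ends selected. The
  theorem is therefore a consequence of a bound for arbitrary finite graphs
  (\<open>poisson_approx_edges_within\<close>): if every degree is at most \<open>D\<close> and the vertices are selected
  independently with probability \<open>p\<close>, then the number \<open>W\<close> of selected edges is within total
  variation distance \<open>2 D p\<close> of the Poisson law of rate \<open>r = \<bar>E\<bar> p\<^sup>2\<close>. The hypothesis on \<open>p\<close>
  says exactly that \<open>D p\<close> tends to \<open>0\<close>.

  The bound comes from the Stein--Chen method. For a set \<open>A\<close> of naturals let \<open>g\<close> solve
  \<open>r g(j + 1) - j g(j) = 1\<^sub>A(j) - Po(r)(A)\<close>. Put \<open>j = W\<close> and take expectations: the right-hand
  side becomes the quantity to be estimated. On the left, \<open>W\<close> is the sum over the edges \<open>e\<close> of the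
  indicators of \<open>e \<subseteq> S\<close>, where \<open>S\<close> is the selected set, and conditioning on \<open>e \<subseteq> S\<close> has the
  same effect as adding \<open>e\<close> to \<open>S\<close> (\<open>expectation_random_subset_edge\<close>). Thus the left-hand side is
  the sum over \<open>e\<close> of \<open>p\<^sup>2 E[g(W(S) + 1) - g(W(e \<union> S))]\<close>. Two facts make each term small.
  First, \<open>g\<close> is Lipschitz with constant \<open>1 / r\<close> (\<open>stein_solution_lipschitz\<close>); the factor \<open>1 / r\<close>
  cancels the factor \<open>\<bar>E\<bar> p\<^sup>2\<close> that the sum contributes, so the rate may be unbounded. Second,
  \<open>W(e \<union> S)\<close> differs from \<open>W(S) + 1\<close> by at most the number of selected neighbours of the two ends
  of \<open>e\<close> (\<open>edges_within_insert_edge\<close>), whose expectation is at most \<open>2 D p\<close>.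
\<close>

section \<open>The Stein equation of the Poisson law\<close>

text \<open>
  At \<open>j + 1\<close> this is the covariance of the events \<open>A\<close> and \<open>{..j}\<close> under the Poisson law \<open>P\<close>,
  divided by \<open>r * P {j}\<close>, which is the closed form of the recursion that the Stein equation imposes.
  That equation leaves the value at \<open>0\<close> free. The truncated subtraction gives it the value at \<open>1\<close>,
  which is harmless for the Lipschitz bound.
\<close>
definition stein_solution :: "real \<Rightarrow> nat set \<Rightarrow> nat \<Rightarrow> real" where
  "stein_solution r A j =
     (let P = measure_pmf.prob (poisson_pmf r) in
       (P ({..j - 1} \<inter> A) - P A * P {..j - 1}) / (r * pmf (poisson_pmf r) (j - 1)))"

lemma pmf_poisson_Suc:
  assumes "r > 0"
  shows "real (Suc i) * pmf (poisson_pmf r) (Suc i) = r * pmf (poisson_pmf r) i"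
  using assms by (simp add: field_simps del: of_nat_Suc)

lemma poisson_partial_sums_tendsto:
  assumes "r > 0"
  shows "(\<lambda>m. \<Sum>l\<le>m. pmf (poisson_pmf r) l) \<longlonglongrightarrow> 1"
proof -
  have "(\<lambda>l. (r ^ l /\<^sub>R fact l) * exp (- r)) sums (exp r * exp (- r))"
    by (intro sums_mult2 exp_converges)
  moreover have "(\<lambda>l. (r ^ l /\<^sub>R fact l) * exp (- r)) = pmf (poisson_pmf r)"
    using assms by (auto simp: field_simps)
  ultimately have "pmf (poisson_pmf r) sums 1"
    by (simp add: exp_minus)
  then show ?thesis
    by (simp add: sums_def_le)
qed

text \<open>
  The Poisson weights satisfy \<open>r * P {l} = (l + 1) * P {l + 1}\<close>. For \<open>l \<le> i\<close> the factor
  \<open>(l + 1) / (i + 1)\<close> is at most \<open>1\<close>, and the sum of the shifted weights \<open>P {l + 1}\<close> misses only the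
  weight at \<open>0\<close>.
\<close>
lemma poisson_head_ratio:
  assumes "r > 0"
  shows "r / real (Suc i) * measure_pmf.prob (poisson_pmf r) {..i} \<le> measure_pmf.prob (poisson_pmf r) {..Suc i}"
proof -
  have "r / real (Suc i) * (\<Sum>l\<le>i. pmf (poisson_pmf r) l)
      = (\<Sum>l\<le>i. real (Suc l) / real (Suc i) * pmf (poisson_pmf r) (Suc l))"
    unfolding sum_distrib_left
  proof (rule sum.cong)
    fix l
    show "r / real (Suc i) * pmf (poisson_pmf r) l
        = real (Suc l) / real (Suc i) * pmf (poisson_pmf r) (Suc l)"
      using pmf_poisson_Suc[OF assms, of l] by (simp add: field_simps del: of_nat_Suc)
  qed simp
  also have "\<dots> \<le> (\<Sum>l\<le>i. pmf (poisson_pmf r) (Suc l))"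
    by (intro sum_mono mult_left_le_one_le) auto
  also have "\<dots> \<le> (\<Sum>l\<le>Suc i. pmf (poisson_pmf r) l)"
    unfolding sum.atMost_Suc_shift by simp
  finally show ?thesis by (simp add: measure_measure_pmf_finite)
qed

text \<open>
  The same recursion read above \<open>i\<close>, where \<open>r / (l + 1) \<le> r / (i + 1)\<close>: each weight of the tail
  beyond \<open>Suc i\<close> is at most \<open>r / Suc i\<close> times its predecessor. The comparison is made for finite
  blocks of length \<open>d\<close>, and then \<open>d\<close> tends to infinity.
\<close>
lemma poisson_tail_ratio:
  assumes "r > 0"
  shows "1 - measure_pmf.prob (poisson_pmf r) {..Suc i}
           \<le> r / real (Suc i) * (1 - measure_pmf.prob (poisson_pmf r) {..i})"
proof -
  let ?F = "\<lambda>m. \<Sum>l\<le>m. pmf (poisson_pmf r) l"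
  have fin: "?F (Suc i + d) - ?F (Suc i) \<le> r / real (Suc i) * (?F (i + d) - ?F i)" for d
  proof (induction d)
    case (Suc d)
    let ?m = "Suc (i + d)"
    have "pmf (poisson_pmf r) (Suc ?m) = r / real (Suc ?m) * pmf (poisson_pmf r) ?m"
      using pmf_poisson_Suc[OF assms, of ?m] by (simp add: field_simps del: of_nat_Suc)
    also have "\<dots> \<le> r / real (Suc i) * pmf (poisson_pmf r) ?m"
      using assms by (intro mult_right_mono divide_left_mono) auto
    finally show ?case
      using Suc by (simp add: ring_distribs del: of_nat_Suc pmf_poisson)
  qed simp
  have "(\<lambda>d. ?F (Suc i + d) - ?F (Suc i)) \<longlonglongrightarrow> 1 - ?F (Suc i)"
    using LIMSEQ_ignore_initial_segment[OF poisson_partial_sums_tendsto[OF assms], of "Suc i"]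
    by (intro tendsto_diff tendsto_const) (simp add: add.commute)
  moreover have "(\<lambda>d. r / real (Suc i) * (?F (i + d) - ?F i)) \<longlonglongrightarrow> r / real (Suc i) * (1 - ?F i)"
    using LIMSEQ_ignore_initial_segment[OF poisson_partial_sums_tendsto[OF assms], of i]
    by (intro tendsto_mult tendsto_diff tendsto_const) (simp add: add.commute)
  ultimately show ?thesis
    unfolding measure_measure_pmf_finite[OF finite_atMost] by (rule LIMSEQ_le) (use fin in blast)
qed

lemma prob_atMost_Suc_Int:
  fixes M :: "nat pmf"
  shows "measure_pmf.prob M ({..Suc i} \<inter> A)
           = measure_pmf.prob M ({..i} \<inter> A) + indicator A (Suc i) * pmf M (Suc i)"
proof (cases "Suc i \<in> A")
  case True
  then have "{..Suc i} \<inter> A = insert (Suc i) ({..i} \<inter> A)" by auto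
  then show ?thesis using True by (simp add: measure_measure_pmf_finite)
next
  case False
  then have "{..Suc i} \<inter> A = {..i} \<inter> A" by (auto simp: le_Suc_eq)
  then show ?thesis using False by simp
qed

lemma stein_equation:
  assumes "r > 0"
  shows "r * stein_solution r A (Suc j) - real j * stein_solution r A j
           = indicator A j - measure_pmf.prob (poisson_pmf r) A"
proof -
  define P where "P = measure_pmf.prob (poisson_pmf r)"
  define q where "q = pmf (poisson_pmf r) j"
  have q: "q > 0" using assms by (simp add: q_def)
  have up: "r * stein_solution r A (Suc j) = (P ({..j} \<inter> A) - P A * P {..j}) / q"
    using assms by (simp add: stein_solution_def Let_def P_def q_def del: pmf_poisson)
  show ?thesis
  proof (cases j)
    case 0
    have "{..0::nat} \<inter> A = (if 0 \<in> A then {0} else {})" by auto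
    then have "P ({..j} \<inter> A) = indicator A j * q" "P {..j} = q"
      using 0 by (simp_all add: P_def q_def measure_pmf_single atMost_0 del: pmf_poisson)
    with q show ?thesis
      unfolding up using 0 by (simp add: P_def diff_divide_distrib)
  next
    case (Suc i)
    have "real j * stein_solution r A j
        = real j * ((P ({..i} \<inter> A) - P A * P {..i}) / (r * pmf (poisson_pmf r) i))"
      using Suc by (simp add: stein_solution_def Let_def P_def del: pmf_poisson)
    also have "\<dots> = (P ({..i} \<inter> A) - P A * P {..i}) / q"
      using Suc by (simp add: q_def flip: pmf_poisson_Suc[OF assms] del: pmf_poisson of_nat_Suc)
    finally have down: "real j * stein_solution r A j = (P ({..i} \<inter> A) - P A * P {..i}) / q" .
    have "P ({..j} \<inter> A) - P A * P {..j} - (P ({..i} \<inter> A) - P A * P {..i})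
        = (indicator A j - P A) * q"
      using prob_atMost_Suc_Int[of "poisson_pmf r" i A] prob_atMost_Suc_Int[of "poisson_pmf r" i UNIV] Suc
      by (simp add: P_def q_def algebra_simps del: pmf_poisson)
    then show ?thesis
      unfolding up down diff_divide_distrib[symmetric] using q by (simp add: P_def)
  qed
qed

text \<open>This symmetry turns an upper bound on increments for all sets into a lower bound.\<close>
lemma stein_solution_Compl:
  "stein_solution r (- A) j = - stein_solution r A j"
proof -
  define P where "P = measure_pmf.prob (poisson_pmf r)"
  have "P (- A) = 1 - P A"
    using measure_pmf.prob_compl[of A "poisson_pmf r"] by (simp add: P_def Compl_eq_Diff_UNIV)
  moreover have "P ({..i} \<inter> - A) = P {..i} - P ({..i} \<inter> A)" for i
    using measure_pmf.finite_measure_Diff'[of "{..i}" "poisson_pmf r" A]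
    by (simp add: P_def Diff_eq)
  ultimately have "P ({..i} \<inter> - A) - P (- A) * P {..i} = - (P ({..i} \<inter> A) - P A * P {..i})" for i
    by (simp only: left_diff_distrib)
  then show ?thesis
    unfolding stein_solution_def Let_def P_def[symmetric] minus_divide_left by (rule arg_cong)
qed

text \<open>
  Write \<open>F\<close> for \<open>P {..j - 1}\<close>, \<open>q\<close> for \<open>P {j}\<close> and \<open>s\<close> for \<open>r / j\<close>, and split the mass of \<open>A\<close> into \<open>a\<close>
  below \<open>j\<close>, \<open>e * q\<close> at \<open>j\<close> and \<open>b\<close> above \<open>j\<close>. Over the common denominator \<open>r * q\<close> the increment is
  linear in \<open>a\<close>, \<open>b\<close> and \<open>e\<close>. The coefficients of \<open>a\<close> and \<open>b\<close> are nonpositive by the tail and head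
  comparisons, so only the point \<open>j\<close> itself can contribute positively, and it contributes at most
  \<open>q * (1 - (F + q) + s * F) \<le> q\<close>, again by the head comparison.
\<close>
lemma stein_solution_increment_le:
  assumes "r > 0"
  shows "stein_solution r A (Suc j) - stein_solution r A j \<le> 1 / r"
proof (cases j)
  case 0
  then show ?thesis using assms by (simp add: stein_solution_def)
next
  case (Suc i)
  define P where "P = measure_pmf.prob (poisson_pmf r)"
  define q where "q = pmf (poisson_pmf r) j"
  define s where "s = r / real j"
  define F where "F = P {..i}"
  define a where "a = P ({..i} \<inter> A)"
  define e where "e = (indicator A j :: real)"
  define b where "b = P A - a - e * q"
  have q: "q > 0" using assms by (simp add: q_def)
  have s: "s > 0" using assms Suc by (simp add: s_def)
  have e: "0 \<le> e" "e \<le> 1" by (auto simp: e_def indicator_def)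
  have a: "a \<ge> 0" by (simp add: a_def P_def)
  have F: "F \<ge> 0" by (simp add: F_def P_def)
  have aj: "P ({..j} \<inter> A) = a + e * q" and Fj: "P {..j} = F + q"
    using prob_atMost_Suc_Int[of "poisson_pmf r" i A] prob_atMost_Suc_Int[of "poisson_pmf r" i UNIV] Suc
    by (simp_all add: P_def q_def a_def e_def F_def del: pmf_poisson)
  have head: "s * F \<le> F + q"
    using poisson_head_ratio[OF assms, of i] unfolding Fj[symmetric] unfolding s_def F_def P_def Suc .
  have tail: "1 - (F + q) \<le> s * (1 - F)"
    using poisson_tail_ratio[OF assms, of i] unfolding Fj[symmetric] unfolding s_def F_def P_def Suc .
  have "P ({..j} \<inter> A) \<le> P A"
    unfolding P_def by (intro measure_pmf.finite_measure_mono) auto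
  then have b: "b \<ge> 0"
    by (simp add: b_def aj)
  have g1: "stein_solution r A (Suc j) = (a + e * q - P A * (F + q)) / (r * q)"
    unfolding aj[symmetric] Fj[symmetric] by (simp add: stein_solution_def Let_def P_def q_def)
  have "r * pmf (poisson_pmf r) i = real j * q"
    using pmf_poisson_Suc[OF assms, of i] Suc by (simp add: q_def)
  then have "stein_solution r A j = (a - P A * F) / (real j * q)"
    using Suc by (simp add: stein_solution_def Let_def a_def F_def flip: P_def del: pmf_poisson)
  also have "\<dots> = s * (a - P A * F) / (r * q)"
    using assms by (simp add: s_def)
  finally have g2: "stein_solution r A j = s * (a - P A * F) / (r * q)" .
  have "(a + e * q - P A * (F + q)) - s * (a - P A * F)
      = a * ((1 - (F + q)) - s * (1 - F)) + b * (s * F - (F + q)) + e * q * (1 - (F + q) + s * F)"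
    by (simp add: b_def algebra_simps)
  also have "\<dots> \<le> 0 + 0 + 1 * q * 1"
  proof (intro add_mono mult_mono)
    show "a * ((1 - (F + q)) - s * (1 - F)) \<le> 0" "b * (s * F - (F + q)) \<le> 0"
      using a b head tail by (auto intro: mult_nonneg_nonpos)
    have "F + q \<le> 1"
      unfolding Fj[symmetric] P_def by (rule measure_pmf.prob_le_1)
    then show "0 \<le> 1 - (F + q) + s * F"
      using s F by simp
  qed (use e q head in auto)
  finally have "(a + e * q - P A * (F + q)) - s * (a - P A * F) \<le> q" by simp
  then have "((a + e * q - P A * (F + q)) - s * (a - P A * F)) / (r * q) \<le> q / (r * q)"
    using assms q by (intro divide_right_mono) auto
  then show ?thesis
    unfolding g1 g2 diff_divide_distrib[symmetric] using q by simp
qed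

lemma stein_solution_lipschitz:
  assumes "r > 0"
  shows "\<bar>stein_solution r A i - stein_solution r A j\<bar> \<le> \<bar>real i - real j\<bar> / r"
proof -
  have step: "\<bar>stein_solution r A (Suc j) - stein_solution r A j\<bar> \<le> 1 / r" for j
    using stein_solution_increment_le[OF assms, of A j]
      stein_solution_increment_le[OF assms, of "- A" j]
    by (simp add: stein_solution_Compl abs_le_iff)
  have up: "\<bar>stein_solution r A (j + d) - stein_solution r A j\<bar> \<le> real d / r" for j d
  proof (induction d)
    case (Suc d)
    then show ?case using step[of "j + d"] by (simp add: add_divide_distrib)
  qed simp
  show ?thesis
    using up[of j "i - j"] up[of i "j - i"]
    by (cases "i \<le> j") (auto simp: abs_minus_commute of_nat_diff)
qed

section \<open>Independent selection of vertices\<close>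
definition random_subset :: "'v set \<Rightarrow> real \<Rightarrow> 'v set pmf" where
  "random_subset U p = map_pmf (\<lambda>sel. {x \<in> U. sel x}) (Pi_pmf U False (\<lambda>_. bernoulli_pmf p))"

lemma set_pmf_random_subset: "set_pmf (random_subset U p) \<subseteq> Pow U"
  by (auto simp: random_subset_def)

lemma finite_set_pmf_random_subset: "finite U \<Longrightarrow> finite (set_pmf (random_subset U p))"
  by (rule finite_subset[OF set_pmf_random_subset]) simp

lemma integrable_random_subset:
  fixes h :: "'v set \<Rightarrow> real"
  assumes "finite U"
  shows "integrable (measure_pmf (random_subset U p)) h"
  by (rule integrable_measure_pmf_finite[OF finite_set_pmf_random_subset[OF assms]])

lemma random_subset_insert:
  assumes "finite U" "a \<notin> U"
  shows "random_subset (insert a U) p =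
           bind_pmf (bernoulli_pmf p)
             (\<lambda>b. map_pmf (\<lambda>S. if b then insert a S else S) (random_subset U p))"
proof -
  have "{x \<in> insert a U. (sel(a := b)) x} = (if b then insert a {x \<in> U. sel x} else {x \<in> U. sel x})"
    for sel b
    using assms(2) by (cases b) auto
  then show ?thesis
    using assms
    by (simp add: random_subset_def Pi_pmf_insert' map_bind_pmf pmf.map_comp comp_def flip: map_pmf_def)
qed

text \<open>
  Membership of \<open>a\<close> is independent of the rest of the random subset, so conditioning on it amounts
  to inserting \<open>a\<close> by force.
\<close>
lemma expectation_random_subset_member:
  fixes h :: "'v set \<Rightarrow> real"
  assumes "finite U" "a \<in> U" "0 \<le> p" "p \<le> 1"
  shows "measure_pmf.expectation (random_subset U p) (\<lambda>S. of_bool (a \<in> S) * h S)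
           = p * measure_pmf.expectation (random_subset U p) (\<lambda>S. h (insert a S))"
proof -
  define U' where "U' = U - {a}"
  have U': "U = insert a U'" "finite U'" "a \<notin> U'" using assms by (auto simp: U'_def)
  have nin: "a \<notin> S" if "S \<in> set_pmf (random_subset U' p)" for S
    using that set_pmf_random_subset[of U' p] U' by auto
  have fin: "finite (set_pmf (random_subset U' p))"
    by (rule finite_set_pmf_random_subset[OF U'(2)])
  have exp: "measure_pmf.expectation (random_subset U p) f =
      p * measure_pmf.expectation (random_subset U' p) (\<lambda>S. f (insert a S))
      + (1 - p) * measure_pmf.expectation (random_subset U' p) f" for f :: "'v set \<Rightarrow> real"
    unfolding U'(1) random_subset_insert[OF U'(2,3)]
    using assms fin by (subst pmf_expectation_bind[where A = UNIV]) (auto simp: UNIV_bool)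
  have "measure_pmf.expectation (random_subset U' p) (\<lambda>S. of_bool (a \<in> S) * h S)
      = measure_pmf.expectation (random_subset U' p) (\<lambda>S. 0)"
    using nin by (intro integral_cong_AE) (auto simp: AE_measure_pmf_iff)
  then show ?thesis
    unfolding exp by (simp add: algebra_simps)
qed

lemma expectation_card_Int_random_subset:
  assumes "finite U" "N \<subseteq> U" "0 \<le> p" "p \<le> 1"
  shows "measure_pmf.expectation (random_subset U p) (\<lambda>S. real (card (N \<inter> S))) = p * real (card N)"
proof -
  have N: "finite N" using assms finite_subset by blast
  have "real (card (N \<inter> S)) = (\<Sum>x\<in>N. of_bool (x \<in> S))" for S
    using N by (simp add: of_bool_def sum.If_cases Int_def)
  then have "measure_pmf.expectation (random_subset U p) (\<lambda>S. real (card (N \<inter> S)))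
      = (\<Sum>x\<in>N. measure_pmf.expectation (random_subset U p) (\<lambda>S. of_bool (x \<in> S)))"
    using assms by (simp add: integrable_random_subset Bochner_Integration.integral_sum)
  also have "\<dots> = (\<Sum>x\<in>N. p)"
    using expectation_random_subset_member[OF assms(1) _ assms(3,4), of _ "\<lambda>_. 1"] assms(2)
    by (intro sum.cong) auto
  finally show ?thesis by simp
qed

section \<open>Poisson approximation for the number of selected edges\<close>
definition edges_within :: "'v set set \<Rightarrow> 'v set \<Rightarrow> nat" where
  "edges_within E S = card {e \<in> E. e \<subseteq> S}"

text \<open>
  If the edge \<open>{a, b}\<close> is already inside \<open>S\<close>, then nothing changes and the difference is \<open>1\<close>, which
  is paid for by \<open>b\<close> as a neighbour of \<open>a\<close> in \<open>S\<close>. Otherwise the successor accounts for \<open>{a, b}\<close>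
  itself, and any other new edge has exactly one end in \<open>{a, b}\<close>, so its other end is a neighbour in
  \<open>S\<close> of \<open>a\<close> or of \<open>b\<close>.
\<close>
lemma edges_within_insert_edge:
  assumes "finite U" "E \<subseteq> nsets U 2" "{a, b} \<in> E"
  shows "\<bar>real (Suc (edges_within E S)) - real (edges_within E (insert a (insert b S)))\<bar>
           \<le> real (card ({y. {a, y} \<in> E} \<inter> S)) + real (card ({y. {b, y} \<in> E} \<inter> S))"
proof -
  define T where "T = insert a (insert b S)"
  define N where "N x = {y. {x, y} \<in> E}" for x
  define ES where "ES = {e \<in> E. e \<subseteq> S}"
  define ET where "ET = {e \<in> E. e \<subseteq> T}"
  have "finite E"
    using assms(1,2) finite_imp_finite_nsets finite_subset by blast
  then have fin: "finite ES" "finite ET" by (auto simp: ES_def ET_def)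
  have "N x \<subseteq> U" for x
    using assms(2) by (auto simp: N_def nsets_def)
  then have finN: "finite (N x \<inter> S)" for x
    using assms(1) finite_subset by blast
  show ?thesis
  proof (cases "{a, b} \<subseteq> S")
    case True
    then have "T = S" by (auto simp: T_def)
    moreover have "b \<in> N a \<inter> S" using True assms(3) by (simp add: N_def)
    then have "card (N a \<inter> S) > 0" using finN by (auto simp: card_gt_0_iff)
    ultimately show ?thesis
      by (simp add: N_def T_def)
  next
    case False
    define R where "R = ET - ES - {{a, b}}"
    have "{a, b} \<in> ET - ES"
      using False assms(3) by (auto simp: ES_def ET_def T_def)
    then have "card (ET - ES) = Suc (card R)"
      unfolding R_def using fin by (intro card.remove) auto
    moreover have "card ET = card ES + card (ET - ES)"
    proof -
      have "ES \<subseteq> ET" by (auto simp: ES_def ET_def T_def)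
      with fin show ?thesis
        using card_mono[of ET ES] card_Diff_subset[of ES ET] by linarith
    qed
    moreover have "card R \<le> card (N a \<inter> S) + card (N b \<inter> S)"
    proof -
      have "R \<subseteq> (\<lambda>y. {a, y}) ` (N a \<inter> S) \<union> (\<lambda>y. {b, y}) ` (N b \<inter> S)"
      proof
        fix f assume f: "f \<in> R"
        then have "f \<in> nsets U 2"
          using assms(2) by (auto simp: R_def ET_def)
        then obtain x y where xy: "f = {x, y}" "x \<noteq> y"
          by (rule nsets2_E)
        show "f \<in> (\<lambda>y. {a, y}) ` (N a \<inter> S) \<union> (\<lambda>y. {b, y}) ` (N b \<inter> S)"
          using f xy by (auto simp: R_def ET_def ES_def T_def N_def insert_commute)
      qed
      then have "card R \<le> card ((\<lambda>y. {a, y}) ` (N a \<inter> S) \<union> (\<lambda>y. {b, y}) ` (N b \<inter> S))"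
        using finN by (intro card_mono) auto
      also have "\<dots> \<le> card ((\<lambda>y. {a, y}) ` (N a \<inter> S)) + card ((\<lambda>y. {b, y}) ` (N b \<inter> S))"
        by (rule card_Un_le)
      also have "\<dots> \<le> card (N a \<inter> S) + card (N b \<inter> S)"
        using finN by (intro add_mono card_image_le)
      finally show ?thesis .
    qed
    ultimately have "\<bar>real (Suc (card ES)) - real (card ET)\<bar>
        \<le> real (card (N a \<inter> S)) + real (card (N b \<inter> S))"
      by simp
    then show ?thesis
      by (simp add: edges_within_def ES_def ET_def N_def T_def)
  qed
qed

lemma expectation_random_subset_edge:
  fixes h :: "'v set \<Rightarrow> real"
  assumes "finite U" "a \<in> U" "b \<in> U" "a \<noteq> b" "0 \<le> p" "p \<le> 1"
  shows "measure_pmf.expectation (random_subset U p) (\<lambda>S. of_bool ({a, b} \<subseteq> S) * h S)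
           = p\<^sup>2 * measure_pmf.expectation (random_subset U p) (\<lambda>S. h (insert a (insert b S)))"
proof -
  let ?E = "measure_pmf.expectation (random_subset U p)"
  have "?E (\<lambda>S. of_bool ({a, b} \<subseteq> S) * h S) = ?E (\<lambda>S. of_bool (a \<in> S) * (of_bool (b \<in> S) * h S))"
    by (intro Bochner_Integration.integral_cong) auto
  also have "\<dots> = p * ?E (\<lambda>S. of_bool (b \<in> S) * h (insert a S))"
    using assms by (subst expectation_random_subset_member) simp_all
  also have "\<dots> = p * (p * ?E (\<lambda>S. h (insert a (insert b S))))"
    using assms by (subst expectation_random_subset_member) simp_all
  finally show ?thesis by (simp add: power2_eq_square)
qed

text \<open>
  The Stein--Chen argument. The rate vanishes only if no vertex is ever selected or there is no edge;
  then both laws are the point mass at \<open>0\<close>. For a positive rate the Stein equation, evaluated at the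
  number of selected edges, reduces the difference of probabilities to a sum over the edges, in which
  an edge contributes at most \<open>p\<^sup>2 * (2 * D * p / r)\<close>.
\<close>
lemma poisson_approx_edges_within:
  assumes "finite U" "E \<subseteq> nsets U 2" "0 \<le> p" "p \<le> 1"
    and deg: "\<And>x. x \<in> U \<Longrightarrow> card {y. {x, y} \<in> E} \<le> D"
  shows "\<bar>measure_pmf.prob (map_pmf (edges_within E) (random_subset U p)) A
           - measure_pmf.prob (poisson_law (real (card E) * p\<^sup>2)) A\<bar> \<le> 2 * real D * p"
proof (cases "real (card E) * p\<^sup>2 = 0")
  case True
  have finE: "finite E"
    using assms(1,2) finite_imp_finite_nsets finite_subset by blast
  have "map_pmf (edges_within E) (random_subset U p) = return_pmf 0"
  proof (cases "p = 0")
    case True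
    have "\<not> e \<subseteq> {}" if "e \<in> E" for e
      using that assms(2) by (auto simp: nsets_def)
    then have "{e \<in> E. e = {}} = {}" by blast
    moreover have "bernoulli_pmf 0 = return_pmf False"
    proof (rule pmf_eqI)
      show "pmf (bernoulli_pmf 0) b = pmf (return_pmf False) b" for b
        by (cases b) simp_all
    qed
    then have "random_subset U p = return_pmf {}"
      using True assms(1) by (simp add: random_subset_def)
    ultimately show ?thesis
      by (simp add: edges_within_def)
  next
    case False
    then have "E = {}" using True finE by simp
    then show ?thesis by (simp add: edges_within_def[abs_def])
  qed
  then show ?thesis
    using True assms(3) by (simp add: poisson_law_def)
next
  case False
  define r where "r = real (card E) * p\<^sup>2"
  have "r \<ge> 0" by (simp add: r_def)
  with False have r: "r > 0" by (simp flip: r_def)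
  define g where "g = stein_solution r A"
  define W where "W = edges_within E"
  define \<mu> where "\<mu> = random_subset U p"
  note int = integrable_random_subset[OF assms(1), of p, folded \<mu>_def]
  have finE: "finite E"
    using assms(1,2) finite_imp_finite_nsets finite_subset by blast
  have edge: "measure_pmf.expectation \<mu> (\<lambda>S. of_bool (e \<subseteq> S) * g (W S))
      = p\<^sup>2 * measure_pmf.expectation \<mu> (\<lambda>S. g (W (e \<union> S)))"
    and close: "\<bar>measure_pmf.expectation \<mu> (\<lambda>S. g (Suc (W S)) - g (W (e \<union> S)))\<bar> \<le> 2 * real D * p / r"
    if "e \<in> E" for e
  proof -
    have "e \<in> nsets U 2" using that assms(2) by blast
    then obtain a b where e: "e = {a, b}" "a \<in> U" "b \<in> U" "a \<noteq> b"
      by (rule nsets2_E)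
    show "measure_pmf.expectation \<mu> (\<lambda>S. of_bool (e \<subseteq> S) * g (W S))
      = p\<^sup>2 * measure_pmf.expectation \<mu> (\<lambda>S. g (W (e \<union> S)))"
      unfolding \<mu>_def e(1)
      using expectation_random_subset_edge[OF assms(1) e(2-4) assms(3,4), of "\<lambda>S. g (W S)"] by simp
    let ?c = "\<lambda>x S. real (card ({y. {x, y} \<in> E} \<inter> S))"
    have "\<bar>g (Suc (W S)) - g (W (e \<union> S))\<bar> \<le> (?c a S + ?c b S) / r" for S
    proof -
      have "\<bar>g (Suc (W S)) - g (W (e \<union> S))\<bar> \<le> \<bar>real (Suc (W S)) - real (W (e \<union> S))\<bar> / r"
        unfolding g_def by (rule stein_solution_lipschitz[OF r])
      also have "\<dots> \<le> (?c a S + ?c b S) / r"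
        using edges_within_insert_edge[OF assms(1,2), of a b S] that e r
        by (intro divide_right_mono) (simp_all add: W_def)
      finally show ?thesis .
    qed
    then have "measure_pmf.expectation \<mu> (\<lambda>S. \<bar>g (Suc (W S)) - g (W (e \<union> S))\<bar>)
        \<le> measure_pmf.expectation \<mu> (\<lambda>S. (?c a S + ?c b S) / r)"
      by (intro integral_mono int)
    also have "\<dots> = (measure_pmf.expectation \<mu> (?c a) + measure_pmf.expectation \<mu> (?c b)) / r"
      using int by simp
    also have "\<dots> \<le> (p * real D + p * real D) / r"
    proof -
      have "measure_pmf.expectation \<mu> (?c x) \<le> p * real D" if "x \<in> U" for x
      proof -
        have "{y. {x, y} \<in> E} \<subseteq> U" using assms(2) by (auto simp: nsets_def)
        from expectation_card_Int_random_subset[OF assms(1) this assms(3,4)]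
        show ?thesis
          using deg[OF that] assms(3) by (simp add: \<mu>_def mult_left_mono)
      qed
      then show ?thesis
        using e r by (intro divide_right_mono add_mono) auto
    qed
    also have "(p * real D + p * real D) / r = 2 * real D * p / r"
      by simp
    finally show "\<bar>measure_pmf.expectation \<mu> (\<lambda>S. g (Suc (W S)) - g (W (e \<union> S)))\<bar> \<le> 2 * real D * p / r"
      by (rule order.trans[OF integral_abs_bound])
  qed
  have W_sum: "real (W S) = (\<Sum>e\<in>E. of_bool (e \<subseteq> S))" for S
    using finE by (simp add: W_def edges_within_def of_bool_def sum.If_cases Int_def)
  have "measure_pmf.prob (map_pmf W \<mu>) A - measure_pmf.prob (poisson_pmf r) A
      = measure_pmf.expectation \<mu> (\<lambda>S. indicator A (W S) - measure_pmf.prob (poisson_pmf r) A)"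
  proof -
    have "measure_pmf.prob (map_pmf W \<mu>) A = measure_pmf.expectation (map_pmf W \<mu>) (indicator A)"
      by simp
    also have "\<dots> = measure_pmf.expectation \<mu> (\<lambda>S. indicator A (W S))"
      by (rule integral_map_pmf)
    finally show ?thesis using int by simp
  qed
  also have "\<dots> = measure_pmf.expectation \<mu> (\<lambda>S. r * g (Suc (W S)) - real (W S) * g (W S))"
    unfolding g_def stein_equation[OF r] ..
  also have "\<dots> = r * measure_pmf.expectation \<mu> (\<lambda>S. g (Suc (W S)))
      - (\<Sum>e\<in>E. measure_pmf.expectation \<mu> (\<lambda>S. of_bool (e \<subseteq> S) * g (W S)))"
    unfolding W_sum sum_distrib_right using int by (simp add: Bochner_Integration.integral_sum)
  also have "\<dots> = (\<Sum>e\<in>E. p\<^sup>2 * measure_pmf.expectation \<mu> (\<lambda>S. g (Suc (W S)) - g (W (e \<union> S))))"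
    using edge int by (simp add: sum_subtractf r_def right_diff_distrib)
  finally have "\<bar>measure_pmf.prob (map_pmf W \<mu>) A - measure_pmf.prob (poisson_pmf r) A\<bar>
      = \<bar>\<Sum>e\<in>E. p\<^sup>2 * measure_pmf.expectation \<mu> (\<lambda>S. g (Suc (W S)) - g (W (e \<union> S)))\<bar>"
    by simp
  also have "\<dots> \<le> (\<Sum>e\<in>E. p\<^sup>2 * (2 * real D * p / r))"
  proof (rule order.trans[OF sum_abs], rule sum_mono)
    fix e assume "e \<in> E"
    from mult_left_mono[OF close[OF this], of "p\<^sup>2"]
    show "\<bar>p\<^sup>2 * measure_pmf.expectation \<mu> (\<lambda>S. g (Suc (W S)) - g (W (e \<union> S)))\<bar>
        \<le> p\<^sup>2 * (2 * real D * p / r)"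
      by (simp only: abs_mult abs_power2 zero_le_power2)
  qed
  also have "\<dots> = r * (2 * real D * p / r)"
    by (simp add: r_def)
  also have "\<dots> = 2 * real D * p"
    using r by simp
  finally show ?thesis
    using r by (simp add: W_def \<mu>_def poisson_law_def flip: r_def)
qed

section \<open>Disjoint pairs as edges of the Kneser graph\<close>
lemma tv_dist_le:
  assumes "\<And>B. \<bar>measure_pmf.prob \<mu> B - measure_pmf.prob \<nu> B\<bar> \<le> c"
  shows "tv_dist \<mu> \<nu> \<le> c"
  unfolding tv_dist_def by (rule cSUP_least) (use assms in auto)

lemma tv_dist_nonneg: "0 \<le> tv_dist \<mu> \<nu>"
proof -
  have "\<bar>measure_pmf.prob \<mu> B - measure_pmf.prob \<nu> B\<bar> \<le> 1" for B
    using measure_pmf.prob_le_1[of \<mu> B] measure_pmf.prob_le_1[of \<nu> B]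
      measure_nonneg[of \<mu> B] measure_nonneg[of \<nu> B] by linarith
  then have "bdd_above (range (\<lambda>B. \<bar>measure_pmf.prob \<mu> B - measure_pmf.prob \<nu> B\<bar>))"
    by (intro bdd_aboveI2)
  from cSUP_upper[OF _ this, of "{}"] show ?thesis
    by (simp add: tv_dist_def)
qed

lemma disjoint_pairs_subset_nsets: "disjoint_pairs F \<subseteq> nsets F 2"
proof
  fix e assume "e \<in> disjoint_pairs F"
  then obtain A B where "e = {A, B}" "A \<in> F" "B \<in> F" "A \<noteq> B"
    unfolding disjoint_pairs_def by blast
  then show "e \<in> nsets F 2" by simp
qed

lemma disjoint_pairs_within:
  assumes "F \<subseteq> G"
  shows "disjoint_pairs F = {e \<in> disjoint_pairs G. e \<subseteq> F}"
proof (intro set_eqI iffI)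
  fix e assume "e \<in> {e \<in> disjoint_pairs G. e \<subseteq> F}"
  then obtain A B where "e = {A, B}" "A \<noteq> B" "A \<inter> B = {}" "e \<subseteq> F"
    unfolding disjoint_pairs_def by blast
  then show "e \<in> disjoint_pairs F"
    unfolding disjoint_pairs_def by blast
next
  fix e assume "e \<in> disjoint_pairs F"
  then obtain A B where e: "e = {A, B}" "A \<in> F" "B \<in> F" "A \<noteq> B" "A \<inter> B = {}"
    unfolding disjoint_pairs_def by blast
  then have "A \<in> G" "B \<in> G" using assms by blast+
  with e show "e \<in> {e \<in> disjoint_pairs G. e \<subseteq> F}"
    unfolding disjoint_pairs_def by blast
qed

text \<open>
  The hypothesis \<open>0 < k\<close> keeps \<open>A\<close> from being disjoint from itself: for \<open>k = 0\<close> the only \<open>k\<close>-subset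
  is the empty set, which has no neighbour, while the binomial coefficient is \<open>1\<close>.
\<close>
lemma card_kneser_neighbours:
  assumes "finite V" "0 < k" "A \<in> nsets V k"
  shows "card {B. {A, B} \<in> disjoint_pairs (nsets V k)} = (card V - k) choose k"
proof -
  have A: "A \<subseteq> V" "finite A" "card A = k" using assms(3) by (auto simp: nsets_def)
  have "{B. {A, B} \<in> disjoint_pairs (nsets V k)} = nsets (V - A) k"
  proof (intro set_eqI iffI)
    fix B assume "B \<in> nsets (V - A) k"
    then have "B \<in> nsets V k" and disj: "A \<inter> B = {}"
      by (auto simp: nsets_def)
    moreover have "A \<noteq> {}" using A assms(2) by auto
    with disj have "B \<noteq> A" by auto
    ultimately show "B \<in> {B. {A, B} \<in> disjoint_pairs (nsets V k)}"
      using assms(3) by (auto simp: disjoint_pairs_def)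
  next
    fix B assume "B \<in> {B. {A, B} \<in> disjoint_pairs (nsets V k)}"
    then show "B \<in> nsets (V - A) k"
      by (auto simp: disjoint_pairs_def nsets_def doubleton_eq_iff)
  qed
  then have "card {B. {A, B} \<in> disjoint_pairs (nsets V k)} = card (V - A) choose k"
    by simp
  also have "card (V - A) = card V - k"
    using A by (simp add: card_Diff_subset)
  finally show ?thesis .
qed

text \<open>Double counting of the incidences between vertices and edges.\<close>
lemma card_kneser_edges:
  assumes "finite V" "0 < k"
  shows "2 * card (disjoint_pairs (nsets V k)) = (card V choose k) * ((card V - k) choose k)"
proof -
  let ?U = "nsets V k" let ?E = "disjoint_pairs ?U"
  have fin: "finite ?U" "finite ?E"
    using assms(1) by (auto intro: finite_imp_finite_nsets finite_subset[OF disjoint_pairs_subset_nsets])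
  have "(\<Sum>A\<in>?U. card {e \<in> ?E. A \<in> e}) = 2 * card ?E"
  proof (rule sum_multicount[OF fin], rule ballI)
    fix e assume "e \<in> ?E"
    then have "e \<in> nsets ?U 2" using disjoint_pairs_subset_nsets by blast
    then have "e \<subseteq> ?U" "card e = 2" by (auto simp: nsets_def)
    moreover from this have "{A \<in> ?U. A \<in> e} = e" by blast
    ultimately show "card {A \<in> ?U. A \<in> e} = 2" by simp
  qed
  moreover have "card {e \<in> ?E. A \<in> e} = (card V - k) choose k" if "A \<in> ?U" for A
  proof -
    have "bij_betw (\<lambda>B. {A, B}) {B. {A, B} \<in> ?E} {e \<in> ?E. A \<in> e}"
    proof (rule bij_betwI')
      fix e assume e: "e \<in> {e \<in> ?E. A \<in> e}"
      then have "e \<in> nsets ?U 2" using disjoint_pairs_subset_nsets by blast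
      then obtain x y where "e = {x, y}" by (rule nsets2_E)
      then show "\<exists>B\<in>{B. {A, B} \<in> ?E}. e = {A, B}"
        using e by (auto simp: insert_commute)
    qed (auto simp: doubleton_eq_iff)
    from bij_betw_same_card[OF this] show ?thesis
      using card_kneser_neighbours[OF assms that] by simp
  qed
  then have "(\<Sum>A\<in>?U. card {e \<in> ?E. A \<in> e}) = (\<Sum>A\<in>?U. (card V - k) choose k)"
    by (intro sum.cong) auto
  ultimately show ?thesis by simp
qed

lemma random_family_eq: "random_family V k p = random_subset (nsets V k) p"
  by (simp add: random_family_def random_subset_def)

lemma tv_dist_disjoint_pairs_le:
  assumes "finite V" "0 < k" "0 \<le> p" "p \<le> 1"
  shows "tv_dist (map_pmf (\<lambda>F. card (disjoint_pairs F)) (random_family V k p))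
           (poisson_law (1 / 2 * real (card V choose k) * real ((card V - k) choose k) * p\<^sup>2))
         \<le> 2 * real ((card V - k) choose k) * p"
proof (rule tv_dist_le)
  fix B
  let ?U = "nsets V k" let ?E = "disjoint_pairs ?U"
  have rate: "1 / 2 * real (card V choose k) * real ((card V - k) choose k)
      = real (card ?E)"
    using arg_cong[OF card_kneser_edges[OF assms(1,2)], of real] by simp
  have law: "map_pmf (\<lambda>F. card (disjoint_pairs F)) (random_family V k p)
      = map_pmf (edges_within ?E) (random_subset ?U p)"
    unfolding random_family_eq
  proof (rule map_pmf_cong[OF refl])
    fix F assume "F \<in> set_pmf (random_subset ?U p)"
    then have "F \<subseteq> ?U" using set_pmf_random_subset[of ?U p] by auto
    from disjoint_pairs_within[OF this] show "card (disjoint_pairs F) = edges_within ?E F"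
      by (simp add: edges_within_def)
  qed
  show "\<bar>measure_pmf.prob (map_pmf (\<lambda>F. card (disjoint_pairs F)) (random_family V k p)) B
      - measure_pmf.prob (poisson_law (1 / 2 * real (card V choose k) * real ((card V - k) choose k) * p\<^sup>2)) B\<bar>
      \<le> 2 * real ((card V - k) choose k) * p"
    unfolding rate law
    using finite_imp_finite_nsets[OF assms(1)] disjoint_pairs_subset_nsets assms(3,4)
      card_kneser_neighbours[OF assms(1,2)]
    by (intro poisson_approx_edges_within) simp_all
qed

theorem theorem2:
  fixes V :: "nat \<Rightarrow> 'a set" and k :: "nat \<Rightarrow> nat" and p :: "nat \<Rightarrow> real"
  assumes "\<And>n. finite (V n)" and "\<And>n. card (V n) = n"
    and "eventually (\<lambda>n. 0 < k n \<and> 2 * k n < n) sequentially"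
    and "filterlim k at_top sequentially"
    and "eventually (\<lambda>n. 0 \<le> p n \<and> p n \<le> 1) sequentially"
    and "p \<in> o[sequentially](\<lambda>n. 1 / real ((n - k n) choose k n))"
  shows "(\<lambda>n. tv_dist
            (map_pmf (\<lambda>F. card (disjoint_pairs F)) (random_family (V n) (k n) (p n)))
            (poisson_law (1 / 2 * real (n choose k n) * real ((n - k n) choose k n) * (p n)\<^sup>2)))
         \<longlonglongrightarrow> 0"
proof (rule tendsto_sandwich)
  show "\<forall>\<^sub>F n in sequentially. 0 \<le> tv_dist
            (map_pmf (\<lambda>F. card (disjoint_pairs F)) (random_family (V n) (k n) (p n)))
            (poisson_law (1 / 2 * real (n choose k n) * real ((n - k n) choose k n) * (p n)\<^sup>2))"
    by (simp add: tv_dist_nonneg)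
  show "\<forall>\<^sub>F n in sequentially. tv_dist
            (map_pmf (\<lambda>F. card (disjoint_pairs F)) (random_family (V n) (k n) (p n)))
            (poisson_law (1 / 2 * real (n choose k n) * real ((n - k n) choose k n) * (p n)\<^sup>2))
         \<le> 2 * (p n / (1 / real ((n - k n) choose k n)))"
    using assms(3,5)
  proof eventually_elim
    case (elim n)
    then show ?case
      using tv_dist_disjoint_pairs_le[OF assms(1)[of n], of "k n" "p n"] assms(2)[of n]
      by (simp add: mult_ac)
  qed
  have "(\<lambda>n. p n / (1 / real ((n - k n) choose k n))) \<longlonglongrightarrow> 0"
    using assms(6) by (rule smalloD_tendsto)
  then show "(\<lambda>n. 2 * (p n / (1 / real ((n - k n) choose k n)))) \<longlonglongrightarrow> 0"
    by (rule tendsto_mult_right_zero)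
qed simp

end
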